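(* Let $\mathbb{K}=\mathbb{R}$ or $\mathbb{K}=\mathbb{C}$, let $(H,\langle\cdot,\cdot\rangle)$ be an inner product space over $\mathbb{K}$ and let $e\in H$ with $\|e\|=1$. Let $\varphi,\gamma,\Phi,\Gamma\in\mathbb{K}$ and $x,y\in H$ be such that $$\operatorname{Re}\langle \Phi e-x,\,x-\varphi e\rangle\ge 0\quad\text{and}\quad \operatorname{Re}\langle \Gamma e-y,\,y-\gamma e\rangle\ge 0,$$ or, equivalently, $$\left\|x-\frac{\varphi+\Phi}{2}e\right\|\le\frac12|\Phi-\varphi|\quad\text{and}\quad \left\|y-\frac{\gamma+\Gamma}{2}e\right\|\le\frac12|\Gamma-\gamma|.$$ Then $$\left|\langle x,y\rangle-\langle x,e\rangle\langle e,y\rangle\right|\le\frac14\,|\Phi-\varphi|\cdot|\Gamma-\gamma|.$$ The constant $\frac14$ is best possible, i.e. for every real $c<\frac14$ there exist an inner product space $H$ over $\mathbb{K}$ and $e,x,y\in H$, $\varphi,\gamma,\Phi,\Gamma\in\mathbb{K}$ satisfying $\|e\|=1$, $\operatorname{Re}\langle \Phi e-x,\,x-\varphi e\rangle\ge 0$ and $\operatorname{Re}\langle \Gamma e-y,\,y-\gamma e\rangle\ge 0$ for which the inequality with $\frac14$ replaced by $c$, namely $\left|\langle x,y\rangle-\langle x,e\rangle\langle e,y\rangle\right|\le c\,|\Phi-\varphi|\cdot|\Gamma-\gamma|$, fails.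
   Context: Inner products are linear in the first argument and conjugate-linear in the second; $\|x\|=\langle x,x\rangle^{1/2}$. *)

theory Defs
  imports Complex_Main "HOL-Library.Product_Plus" "HOL-Analysis.Inner_Product"
begin

text \<open>
  The scalar field K is the real or the complex field. The class describes K through a
  norm-preserving field embedding into the complex numbers whose image is the real line or
  everything, so that its members are exactly the isomorphic copies of these two fields.
  Injectivity of \<open>to_complex\<close> follows from \<open>norm_to_complex\<close>. The real part of a scalar \<open>a\<close>
  is \<open>Re (to_complex a)\<close>, and its modulus is \<open>norm a\<close>.
\<close>

class real_or_complex = real_normed_field +
  fixes to_complex :: "'a \<Rightarrow> complex"
    and scalar_cnj :: "'a \<Rightarrow> 'a"
  assumes to_complex_add: "to_complex (a + b) = to_complex a + to_complex b"
    and to_complex_mult: "to_complex (a * b) = to_complex a * to_complex b"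
    and to_complex_one: "to_complex 1 = 1"
    and to_complex_scaleR: "to_complex (r *\<^sub>R a) = r *\<^sub>R to_complex a"
    and norm_to_complex: "cmod (to_complex a) = norm a"
    and range_to_complex: "range to_complex = \<real> \<or> range to_complex = UNIV"
    and to_complex_cnj: "to_complex (scalar_cnj a) = cnj (to_complex a)"

instantiation real :: real_or_complex
begin
definition to_complex_real :: "real \<Rightarrow> complex" where "to_complex_real a = complex_of_real a"
definition scalar_cnj_real :: "real \<Rightarrow> real" where "scalar_cnj_real a = a"
instance
  by standard (auto simp: to_complex_real_def scalar_cnj_real_def Reals_def scaleR_conv_of_real)
end

instantiation complex :: real_or_complex
begin
definition to_complex_complex :: "complex \<Rightarrow> complex" where "to_complex_complex a = a"
definition scalar_cnj_complex :: "complex \<Rightarrow> complex" where "scalar_cnj_complex a = cnj a"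
instance
  by standard (auto simp: to_complex_complex_def scalar_cnj_complex_def norm_mult)
end

text \<open>
  The library only has inner products over the reals. Here the inner product is linear in the
  first argument and, by \<open>ip_cnj_commute\<close>, conjugate-linear in the second; the same axiom makes
  \<open>ip x x\<close> a real scalar.
\<close>

locale inner_product_space = vector_space scale
  for scale :: "'k::real_or_complex \<Rightarrow> 'v::ab_group_add \<Rightarrow> 'v" +
  fixes ip :: "'v \<Rightarrow> 'v \<Rightarrow> 'k"
  assumes ip_add_left: "ip (x + y) z = ip x z + ip y z"
    and ip_scale_left: "ip (scale a x) y = a * ip x y"
    and ip_cnj_commute: "ip y x = scalar_cnj (ip x y)"
    and ip_self_nonneg: "0 \<le> Re (to_complex (ip x x))"
    and ip_self_eq_0: "ip x x = 0 \<Longrightarrow> x = 0"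

definition ip_norm :: "('v \<Rightarrow> 'v \<Rightarrow> 'k::real_or_complex) \<Rightarrow> 'v \<Rightarrow> real"
  where "ip_norm ip x = sqrt (Re (to_complex (ip x x)))"

lemma inner_product_space_real_inner:
  "inner_product_space scaleR (inner :: 'a::real_inner \<Rightarrow> 'a \<Rightarrow> real)"
  by unfold_locales
    (auto simp: algebra_simps inner_commute to_complex_real_def scalar_cnj_real_def)

lemma ip_norm_real_inner: "ip_norm inner (x :: 'a::real_inner) = norm x"
  by (simp add: ip_norm_def to_complex_real_def norm_eq_sqrt_inner)

lemma inner_product_space_complex:
  "inner_product_space (*) (\<lambda>z w :: complex. z * cnj w)"
  by unfold_locales
    (auto simp: algebra_simps to_complex_complex_def scalar_cnj_complex_def)

end

theory Submission
  imports Defs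
begin

text \<open>
  The quantity \<open>\<langle>x,y\<rangle> - \<langle>x,e\<rangle>\<langle>e,y\<rangle>\<close> is the inner product of the components of \<open>x\<close> and \<open>y\<close>
  orthogonal to the unit vector \<open>e\<close>, so it does not change when multiples of \<open>e\<close> are added to
  \<open>x\<close> or \<open>y\<close>. Replace \<open>x\<close> and \<open>y\<close> by \<open>u = x - ((\<phi> + \<Phi>)/2) e\<close> and \<open>v = y - ((\<gamma> + \<Gamma>)/2) e\<close>: by
  the Cauchy-Schwarz inequality and because projections do not increase the norm
  (\<open>norm_ip_minus_projections_le\<close>), the quantity has modulus at most \<open>\<parallel>u\<parallel> \<parallel>v\<parallel>\<close>.

  The two forms of the hypothesis agree because, with \<open>d = (\<Phi> - \<phi>)/2\<close>, the vectors \<open>\<Phi> e - x\<close> and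
  \<open>x - \<phi> e\<close> are \<open>d e - u\<close> and \<open>d e + u\<close>. The real part of their inner product is the difference of
  squares \<open>\<bar>d\<bar>\<^sup>2 - \<parallel>u\<parallel>\<^sup>2\<close>, which is nonnegative exactly when \<open>\<parallel>u\<parallel> \<le> \<bar>d\<bar>\<close>. Hence
  \<open>\<parallel>u\<parallel> \<parallel>v\<parallel> \<le> \<bar>\<Phi> - \<phi>\<bar> \<bar>\<Gamma> - \<gamma>\<bar> / 4\<close>.

  Equality occurs for \<open>x = y\<close> a unit vector orthogonal to \<open>e\<close>, with \<open>\<phi> = \<gamma> = -1\<close> and
  \<open>\<Phi> = \<Gamma> = 1\<close>: the left side is \<open>1\<close> and \<open>\<bar>\<Phi> - \<phi>\<bar> \<bar>\<Gamma> - \<gamma>\<bar> = 4\<close>. The plane over the scalar field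
  contains such a configuration, so the constant cannot be lowered.

  All computations take place in the complex numbers, after applying the embedding of the scalar
  field, so that the real and the complex case need not be separated.
\<close>

section \<open>The embedding of the scalars\<close>

lemma to_complex_zero [simp]: "to_complex (0 :: 'k::real_or_complex) = 0"
  using to_complex_add[of "0::'k" 0] by simp

lemma to_complex_minus: "to_complex (- a :: 'k::real_or_complex) = - to_complex a"
  using to_complex_add[of a "- a"] by (simp add: eq_neg_iff_add_eq_0 add.commute)

lemma to_complex_diff: "to_complex (a - b :: 'k::real_or_complex) = to_complex a - to_complex b"
  using to_complex_add[of a "- b"] by (simp add: to_complex_minus)

lemma to_complex_eq_iff: "to_complex (a :: 'k::real_or_complex) = to_complex b \<longleftrightarrow> a = b"
  using norm_to_complex[of "a - b"] by (auto simp: to_complex_diff)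

lemmas to_complex_hom =
  to_complex_add to_complex_diff to_complex_minus to_complex_mult to_complex_one to_complex_cnj

section \<open>Cauchy-Schwarz and orthogonal projections\<close>

context inner_product_space
begin

lemma ip_commute: "to_complex (ip y x) = cnj (to_complex (ip x y))"
  using ip_cnj_commute[of y x] by (simp add: to_complex_cnj)

lemma ip_add: "to_complex (ip (x + y) z) = to_complex (ip x z) + to_complex (ip y z)"
  "to_complex (ip z (x + y)) = to_complex (ip z x) + to_complex (ip z y)"
proof -
  show *: "to_complex (ip (x + y) z) = to_complex (ip x z) + to_complex (ip y z)" for x y z
    by (simp add: ip_add_left to_complex_add)
  show "to_complex (ip z (x + y)) = to_complex (ip z x) + to_complex (ip z y)"
    using *[of x y z] by (metis ip_commute complex_cnj_add)
qed

lemma ip_scale: "to_complex (ip (scale a x) y) = to_complex a * to_complex (ip x y)"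
  "to_complex (ip y (scale a x)) = cnj (to_complex a) * to_complex (ip y x)"
proof -
  show *: "to_complex (ip (scale a x) y) = to_complex a * to_complex (ip x y)" for a x y
    by (simp add: ip_scale_left to_complex_mult)
  show "to_complex (ip y (scale a x)) = cnj (to_complex a) * to_complex (ip y x)"
    using *[of a x y] by (metis ip_commute complex_cnj_mult)
qed

lemma ip_diff: "to_complex (ip (x - y) z) = to_complex (ip x z) - to_complex (ip y z)"
  "to_complex (ip z (x - y)) = to_complex (ip z x) - to_complex (ip z y)"
  using ip_add(1)[of "x - y" y z] ip_add(2)[of z "x - y" y] by simp_all

lemma ip_norm_nonneg: "0 \<le> ip_norm ip x"
  by (simp add: ip_norm_def ip_self_nonneg)

lemma ip_self: "to_complex (ip x x) = complex_of_real ((ip_norm ip x)\<^sup>2)"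
  using ip_commute[of x x] by (simp add: ip_norm_def ip_self_nonneg complex_eq_iff)

lemma ip_norm_eq_0: "ip_norm ip x = 0 \<Longrightarrow> x = 0"
  using ip_self[of x] to_complex_eq_iff[of "ip x x" 0] by (auto intro: ip_self_eq_0)

text \<open>
  Expanding \<open>0 \<le> \<parallel>z\<parallel>\<^sup>2\<close> for \<open>z = \<parallel>y\<parallel>\<^sup>2 x - \<langle>x,y\<rangle> y\<close>, a multiple of the component of \<open>x\<close> orthogonal
  to \<open>y\<close>, gives the inequality up to a factor \<open>\<parallel>y\<parallel>\<^sup>2\<close>.
\<close>

lemma ip_Cauchy_Schwarz: "norm (ip x y) \<le> ip_norm ip x * ip_norm ip y"
proof (cases "y = 0")
  case True
  then have "to_complex (ip x y) = 0"
    using ip_diff(2)[of x y y] by simp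
  then have "norm (ip x y) = 0"
    by (metis norm_to_complex norm_zero)
  then show ?thesis
    by (simp add: ip_norm_nonneg)
next
  case False
  define X Y p where "X = (ip_norm ip x)\<^sup>2" and "Y = (ip_norm ip y)\<^sup>2" and "p = to_complex (ip x y)"
  define z where "z = scale (ip y y) x - scale (ip x y) y"
  have Y: "Y > 0"
    using False ip_norm_eq_0[of y] ip_norm_nonneg[of y] by (auto simp: Y_def)
  have "to_complex (ip z z) = complex_of_real Y * (complex_of_real X * complex_of_real Y - p * cnj p)"
    by (simp add: z_def ip_diff ip_scale ip_commute[of y x] ip_self[of x] ip_self[of y]
        flip: X_def Y_def p_def)
  also have "\<dots> = complex_of_real (Y * (X * Y - (cmod p)\<^sup>2))"
    by (simp add: complex_norm_square del: of_real_power)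
  finally have "0 \<le> Y * (X * Y - (cmod p)\<^sup>2)"
    using ip_self_nonneg[of z] by simp
  then have "(cmod p)\<^sup>2 \<le> X * Y"
    using Y by (simp add: zero_le_mult_iff)
  then have "(norm (ip x y))\<^sup>2 \<le> (ip_norm ip x * ip_norm ip y)\<^sup>2"
    by (simp add: X_def Y_def p_def norm_to_complex power_mult_distrib)
  then show ?thesis
    by (rule power2_le_imp_le) (simp add: ip_norm_nonneg)
qed

lemma ip_unit: "ip_norm ip e = 1 \<Longrightarrow> to_complex (ip e e) = 1"
  by (simp add: ip_self)

text \<open>By Pythagoras, subtracting the projection takes \<open>\<bar>\<langle>u,e\<rangle>\<bar>\<^sup>2\<close> off \<open>\<parallel>u\<parallel>\<^sup>2\<close>.\<close>

lemma ip_norm_minus_projection_le: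
  assumes "ip_norm ip e = 1"
  shows "ip_norm ip (u - scale (ip u e) e) \<le> ip_norm ip u"
proof -
  let ?p = "to_complex (ip u e)"
  have "to_complex (ip (u - scale (ip u e) e) (u - scale (ip u e) e))
      = to_complex (ip u u) - ?p * cnj ?p"
    by (simp add: ip_diff ip_scale ip_commute[of e u] ip_unit[OF assms] algebra_simps)
  then have "complex_of_real ((ip_norm ip (u - scale (ip u e) e))\<^sup>2)
      = complex_of_real ((ip_norm ip u)\<^sup>2 - (cmod ?p)\<^sup>2)"
    by (simp only: ip_self complex_norm_square of_real_diff)
  then have "(ip_norm ip (u - scale (ip u e) e))\<^sup>2 = (ip_norm ip u)\<^sup>2 - (cmod ?p)\<^sup>2"
    by (simp only: of_real_eq_iff)
  then have "(ip_norm ip (u - scale (ip u e) e))\<^sup>2 \<le> (ip_norm ip u)\<^sup>2"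
    by simp
  then show ?thesis
    by (rule power2_le_imp_le) (rule ip_norm_nonneg)
qed

text \<open>
  The left side is the inner product of \<open>v\<close> with the component of \<open>u\<close> orthogonal to \<open>e\<close>.
\<close>

lemma norm_ip_minus_projections_le:
  assumes "ip_norm ip e = 1"
  shows "norm (ip u v - ip u e * ip e v) \<le> ip_norm ip u * ip_norm ip v"
proof -
  have "to_complex (ip u v - ip u e * ip e v) = to_complex (ip (u - scale (ip u e) e) v)"
    by (simp add: ip_diff ip_scale to_complex_hom)
  then have "ip u v - ip u e * ip e v = ip (u - scale (ip u e) e) v"
    by (simp only: to_complex_eq_iff)
  then have "norm (ip u v - ip u e * ip e v) \<le> ip_norm ip (u - scale (ip u e) e) * ip_norm ip v"
    using ip_Cauchy_Schwarz by simp
  also have "\<dots> \<le> ip_norm ip u * ip_norm ip v"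
    by (intro mult_right_mono ip_norm_minus_projection_le assms ip_norm_nonneg)
  finally show ?thesis .
qed

text \<open>
  Since \<open>\<langle>e,e\<rangle> = 1\<close>, a shift by a multiple of \<open>e\<close> changes both terms by the same amount. This moves
  the centres of the two balls in the hypotheses to the origin.
\<close>

lemma ip_minus_projections_translate:
  assumes "ip_norm ip e = 1"
  shows "ip (x - scale a e) (y - scale b e) - ip (x - scale a e) e * ip e (y - scale b e)
    = ip x y - ip x e * ip e y"
proof -
  have "to_complex (ip (x - scale a e) (y - scale b e) - ip (x - scale a e) e * ip e (y - scale b e))
      = to_complex (ip x y - ip x e * ip e y)"
    by (simp add: ip_diff ip_scale to_complex_hom ip_unit[OF assms] algebra_simps)
  then show ?thesis
    by (simp only: to_complex_eq_iff)
qed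

section \<open>The Gruss inequality\<close>

text \<open>
  Both sides say that \<open>x\<close> lies in the closed ball that has the segment from \<open>\<phi> e\<close> to \<open>\<Phi> e\<close> as a
  diameter; the left one is the converse of Thales' theorem. Written with the centre \<open>m e\<close> and half
  the diameter \<open>d e\<close>, the left inner product becomes a difference of squares.
\<close>

lemma Re_ip_nonneg_iff_ip_norm_le:
  assumes "ip_norm ip e = 1"
  shows "0 \<le> Re (to_complex (ip (scale \<Phi> e - x) (x - scale \<phi> e))) \<longleftrightarrow>
    ip_norm ip (x - scale ((\<phi> + \<Phi>) / 2) e) \<le> 1 / 2 * norm (\<Phi> - \<phi>)"
proof -
  define m d u where "m = (\<phi> + \<Phi>) / 2" and "d = (\<Phi> - \<phi>) / 2" and "u = x - scale m e"
  have "m + d = \<Phi>" "m - d = \<phi>"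
    by (simp_all add: m_def d_def field_simps)
  then have 1: "scale \<Phi> e - x = scale d e - u" "x - scale \<phi> e = scale d e + u"
    by (auto simp: u_def scale_left_distrib scale_left_diff_distrib)
  \<comment> \<open>The cross terms form a scalar minus its conjugate, which has no real part.\<close>
  have "to_complex (ip (scale d e - u) (scale d e + u))
      = to_complex d * cnj (to_complex d) - complex_of_real ((ip_norm ip u)\<^sup>2)
        + (to_complex (ip (scale d e) u) - cnj (to_complex (ip (scale d e) u)))"
    by (simp add: ip_diff ip_add ip_scale ip_self[of u] ip_commute[of u e] ip_unit[OF assms]
        algebra_simps)
  then have "Re (to_complex (ip (scale d e - u) (scale d e + u))) = (norm d)\<^sup>2 - (ip_norm ip u)\<^sup>2"
    by (simp add: norm_to_complex flip: complex_norm_square of_real_power)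
  then have "0 \<le> Re (to_complex (ip (scale \<Phi> e - x) (x - scale \<phi> e))) \<longleftrightarrow> ip_norm ip u \<le> norm d"
    by (simp add: 1 ip_norm_nonneg)
  then show ?thesis
    by (simp add: u_def m_def d_def norm_divide)
qed

theorem ip_Gruss:
  assumes e: "ip_norm ip e = 1"
    and x: "0 \<le> Re (to_complex (ip (scale \<Phi> e - x) (x - scale \<phi> e)))"
    and y: "0 \<le> Re (to_complex (ip (scale \<Gamma> e - y) (y - scale \<gamma> e)))"
  shows "norm (ip x y - ip x e * ip e y) \<le> 1 / 4 * norm (\<Phi> - \<phi>) * norm (\<Gamma> - \<gamma>)"
proof -
  let ?u = "x - scale ((\<phi> + \<Phi>) / 2) e" and ?v = "y - scale ((\<gamma> + \<Gamma>) / 2) e"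
  have "norm (ip x y - ip x e * ip e y) = norm (ip ?u ?v - ip ?u e * ip e ?v)"
    by (simp only: ip_minus_projections_translate[OF e])
  also have "\<dots> \<le> ip_norm ip ?u * ip_norm ip ?v"
    by (rule norm_ip_minus_projections_le[OF e])
  also have "\<dots> \<le> (1 / 2 * norm (\<Phi> - \<phi>)) * (1 / 2 * norm (\<Gamma> - \<gamma>))"
    using x y by (intro mult_mono) (simp_all only: Re_ip_nonneg_iff_ip_norm_le[OF e] ip_norm_nonneg
        zero_le_mult_iff, auto)
  finally show ?thesis
    by simp
qed

end

section \<open>The plane over the scalar field\<close>

lemma scalar_cnj_hom:
  "scalar_cnj (a + b :: 'k::real_or_complex) = scalar_cnj a + scalar_cnj b"
  "scalar_cnj (a * b) = scalar_cnj a * scalar_cnj b"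
  "scalar_cnj (scalar_cnj a) = a"
  "scalar_cnj (1 :: 'k) = 1" "scalar_cnj (0 :: 'k) = 0" "scalar_cnj (- a) = - scalar_cnj a"
  by (simp_all add: to_complex_hom flip: to_complex_eq_iff)

lemma to_complex_mult_cnj_self:
  "to_complex (a * scalar_cnj a :: 'k::real_or_complex) = complex_of_real ((norm a)\<^sup>2)"
  by (metis to_complex_mult to_complex_cnj norm_to_complex complex_norm_square)

definition plane_scale :: "'k::real_or_complex \<Rightarrow> 'k \<times> 'k \<Rightarrow> 'k \<times> 'k"
  where "plane_scale a p = (a * fst p, a * snd p)"

definition plane_ip :: "'k::real_or_complex \<times> 'k \<Rightarrow> 'k \<times> 'k \<Rightarrow> 'k"
  where "plane_ip p q = fst p * scalar_cnj (fst q) + snd p * scalar_cnj (snd q)"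

lemma inner_product_space_plane:
  "inner_product_space plane_scale (plane_ip :: 'k::real_or_complex \<times> 'k \<Rightarrow> 'k \<times> 'k \<Rightarrow> 'k)"
proof
  fix p q r :: "'k \<times> 'k" and a b :: 'k
  show "plane_scale a (p + q) = plane_scale a p + plane_scale a q"
    "plane_scale (a + b) p = plane_scale a p + plane_scale b p"
    "plane_scale a (plane_scale b p) = plane_scale (a * b) p" "plane_scale 1 p = p"
    by (simp_all add: plane_scale_def prod_eq_iff algebra_simps)
  show "plane_ip (p + q) r = plane_ip p r + plane_ip q r"
    "plane_ip (plane_scale a p) q = a * plane_ip p q"
    "plane_ip q p = scalar_cnj (plane_ip p q)"
    by (simp_all add: plane_ip_def plane_scale_def scalar_cnj_hom algebra_simps)
  have self: "to_complex (plane_ip p p) = complex_of_real ((norm (fst p))\<^sup>2 + (norm (snd p))\<^sup>2)"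
    by (simp only: plane_ip_def to_complex_add to_complex_mult_cnj_self of_real_add)
  then show "0 \<le> Re (to_complex (plane_ip p p))"
    by simp
  show "p = 0" if "plane_ip p p = 0"
  proof -
    have "(norm (fst p))\<^sup>2 + (norm (snd p))\<^sup>2 = 0"
      using self that by (simp del: of_real_add of_real_power)
    then show ?thesis
      by (simp add: sum_power2_eq_zero_iff prod_eq_iff)
  qed
qed

theorem theorem2:
  shows "(\<forall>(scale :: 'k::real_or_complex \<Rightarrow> 'v::ab_group_add \<Rightarrow> 'v) (ip :: 'v \<Rightarrow> 'v \<Rightarrow> 'k)
            (e :: 'v) (\<phi> :: 'k) (\<gamma> :: 'k) (\<Phi> :: 'k) (\<Gamma> :: 'k) (x :: 'v) (y :: 'v).
          inner_product_space scale ip \<longrightarrow> ip_norm ip e = 1 \<longrightarrow>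
            (Re (to_complex (ip (scale \<Phi> e - x) (x - scale \<phi> e))) \<ge> 0 \<longleftrightarrow>
               ip_norm ip (x - scale ((\<phi> + \<Phi>) / 2) e) \<le> 1 / 2 * norm (\<Phi> - \<phi>)) \<and>
            (Re (to_complex (ip (scale \<Gamma> e - y) (y - scale \<gamma> e))) \<ge> 0 \<longleftrightarrow>
               ip_norm ip (y - scale ((\<gamma> + \<Gamma>) / 2) e) \<le> 1 / 2 * norm (\<Gamma> - \<gamma>)) \<and>
            (Re (to_complex (ip (scale \<Phi> e - x) (x - scale \<phi> e))) \<ge> 0 \<longrightarrow>
             Re (to_complex (ip (scale \<Gamma> e - y) (y - scale \<gamma> e))) \<ge> 0 \<longrightarrow>
               norm (ip x y - ip x e * ip e y) \<le> 1 / 4 * norm (\<Phi> - \<phi>) * norm (\<Gamma> - \<gamma>)))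
       \<and> (\<forall>c::real. c < 1 / 4 \<longrightarrow>
          (\<exists>(scale :: 'k \<Rightarrow> 'k \<times> 'k \<Rightarrow> 'k \<times> 'k) (ip :: 'k \<times> 'k \<Rightarrow> 'k \<times> 'k \<Rightarrow> 'k)
             (e :: 'k \<times> 'k) (x :: 'k \<times> 'k) (y :: 'k \<times> 'k)
             (\<phi> :: 'k) (\<gamma> :: 'k) (\<Phi> :: 'k) (\<Gamma> :: 'k).
             inner_product_space scale ip \<and> ip_norm ip e = 1 \<and>
             Re (to_complex (ip (scale \<Phi> e - x) (x - scale \<phi> e))) \<ge> 0 \<and>
             Re (to_complex (ip (scale \<Gamma> e - y) (y - scale \<gamma> e))) \<ge> 0 \<and>
             \<not> norm (ip x y - ip x e * ip e y) \<le> c * norm (\<Phi> - \<phi>) * norm (\<Gamma> - \<gamma>)))"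
proof (intro conjI allI impI)
  fix scale :: "'k \<Rightarrow> 'v \<Rightarrow> 'v" and ip :: "'v \<Rightarrow> 'v \<Rightarrow> 'k" and e x y :: 'v and \<phi> \<gamma> \<Phi> \<Gamma> :: 'k
  assume "inner_product_space scale ip" and e: "ip_norm ip e = 1"
  then interpret inner_product_space scale ip
    by simp
  show "Re (to_complex (ip (scale \<Phi> e - x) (x - scale \<phi> e))) \<ge> 0 \<longleftrightarrow>
      ip_norm ip (x - scale ((\<phi> + \<Phi>) / 2) e) \<le> 1 / 2 * norm (\<Phi> - \<phi>)"
    "Re (to_complex (ip (scale \<Gamma> e - y) (y - scale \<gamma> e))) \<ge> 0 \<longleftrightarrow>
      ip_norm ip (y - scale ((\<gamma> + \<Gamma>) / 2) e) \<le> 1 / 2 * norm (\<Gamma> - \<gamma>)"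
    by (rule Re_ip_nonneg_iff_ip_norm_le[OF e])+
  show "norm (ip x y - ip x e * ip e y) \<le> 1 / 4 * norm (\<Phi> - \<phi>) * norm (\<Gamma> - \<gamma>)"
    if "Re (to_complex (ip (scale \<Phi> e - x) (x - scale \<phi> e))) \<ge> 0"
      and "Re (to_complex (ip (scale \<Gamma> e - y) (y - scale \<gamma> e))) \<ge> 0"
    using that by (rule ip_Gruss[OF e])
next
  fix c :: real
  assume c: "c < 1 / 4"
  let ?e = "(1, 0) :: 'k \<times> 'k" and ?x = "(0, 1) :: 'k \<times> 'k"
  have disc: "Re (to_complex (plane_ip (plane_scale 1 ?e - ?x) (?x - plane_scale (- 1) ?e))) \<ge> 0"
    by (simp add: plane_ip_def plane_scale_def scalar_cnj_hom)
  have "norm (1 - - 1 :: 'k) = 2"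
    by simp
  then have "\<not> norm (plane_ip ?x ?x - plane_ip ?x ?e * plane_ip ?e ?x)
      \<le> c * norm (1 - - 1 :: 'k) * norm (1 - - 1 :: 'k)"
    using c by (simp add: plane_ip_def scalar_cnj_hom)
  moreover have "ip_norm plane_ip ?e = 1"
    by (simp add: ip_norm_def plane_ip_def scalar_cnj_hom to_complex_one)
  ultimately show "\<exists>(scale :: 'k \<Rightarrow> 'k \<times> 'k \<Rightarrow> 'k \<times> 'k) (ip :: 'k \<times> 'k \<Rightarrow> 'k \<times> 'k \<Rightarrow> 'k)
             (e :: 'k \<times> 'k) (x :: 'k \<times> 'k) (y :: 'k \<times> 'k)
             (\<phi> :: 'k) (\<gamma> :: 'k) (\<Phi> :: 'k) (\<Gamma> :: 'k).
             inner_product_space scale ip \<and> ip_norm ip e = 1 \<and>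
             Re (to_complex (ip (scale \<Phi> e - x) (x - scale \<phi> e))) \<ge> 0 \<and>
             Re (to_complex (ip (scale \<Gamma> e - y) (y - scale \<gamma> e))) \<ge> 0 \<and>
             \<not> norm (ip x y - ip x e * ip e y) \<le> c * norm (\<Phi> - \<phi>) * norm (\<Gamma> - \<gamma>)"
    using inner_product_space_plane disc by blast
qed

end
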